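(* If $0 < \dim H^{q}_{\mathrm{d}'}(\mathscr{C}^\infty(\Omega)) < \infty$ for some $q \in \{0, \ldots, n\}$, then $\Gamma_{\pmb{\omega}} = \{0\}$.
   Context: $M$ is a smooth, compact, connected and oriented $n$-dimensional manifold; $\omega_1, \ldots, \omega_m$ are smooth, complex, closed $1$-forms on $M$; $\mathbb{T}^m = \mathbb{R}^m / 2\pi\mathbb{Z}^m$ with coordinates $x$; $\Omega = M \times \mathbb{T}^m$. $\Lambda^q$ is the bundle of complex $q$-forms over $M$ and $\underline{\Lambda}^q$ its pullback under the projection $\Omega \to M$; smooth sections are locally $f = \sum_{|J| = q} f_J(t,x)\, \mathrm{d} t_J$. The operator $\mathrm{d}' = \mathrm{d}_t + \sum_{k=1}^m \omega_k \wedge \partial/\partial x_k$ maps $\mathscr{C}^\infty(\Omega; \underline{\Lambda}^{q})$ to $\mathscr{C}^\infty(\Omega; \underline{\Lambda}^{q+1})$ and squares to zero; spaces in negative degree are zero. $H^q_{\mathrm{d}'}(\mathscr{C}^\infty(\Omega))$ is the kernel of $\mathrm{d}'$ on $\mathscr{C}^\infty(\Omega; \underline{\Lambda}^q)$ modulo $\mathrm{d}'\mathscr{C}^\infty(\Omega; \underline{\Lambda}^{q-1})$. With $\xi\cdot\pmb{\omega} = \sum_k \xi_k\omega_k$, $\Gamma_{\pmb{\omega}}$ is the set (in fact subgroup of $\mathbb{Z}^m$) of those $\xi \in \mathbb{Z}^m$ for which there exists a not identically zero $f \in \mathscr{C}^\infty(M)$ with $\mathrm{d}f + i f\,(\xi\cdot\pmb{\omega})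 = 0$. *)

theory Defs
  imports "HOL-Analysis.Analysis" "HOL-Library.Function_Algebras"
begin

section \<open>Smooth maps on open subsets of normed spaces\<close>

(* For open S: k-times continuously differentiable on S. *)
fun Ck_on :: "nat \<Rightarrow> 'e::real_normed_vector set \<Rightarrow> ('e \<Rightarrow> 'f::real_normed_vector) \<Rightarrow> bool" where
  "Ck_on 0 S f \<longleftrightarrow> continuous_on S f"
| "Ck_on (Suc k) S f \<longleftrightarrow>
     (\<forall>x\<in>S. f differentiable (at x)) \<and> (\<forall>v. Ck_on k S (\<lambda>x. frechet_derivative f (at x) v))"

definition smooth_on :: "'e::real_normed_vector set \<Rightarrow> ('e \<Rightarrow> 'f::real_normed_vector) \<Rightarrow> bool" where
  "smooth_on S f \<longleftrightarrow> (\<forall>k. Ck_on k S f)"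


section \<open>Smooth oriented manifolds\<close>

(* The manifold M is the topological space 'a.  A chart is a pair (U, phi); only the
   restriction of phi to U matters.  The dimension is CARD('n). *)
type_synonym ('a, 'n) chart = "'a set \<times> ('a \<Rightarrow> real ^ 'n)"

definition chart_range :: "('a, 'n::finite) chart \<Rightarrow> (real ^ 'n) set" where
  "chart_range c = snd c ` fst c"

definition chart_inv :: "('a, 'n::finite) chart \<Rightarrow> real ^ 'n \<Rightarrow> 'a" where
  "chart_inv c = inv_into (fst c) (snd c)"

definition transition :: "('a, 'n::finite) chart \<Rightarrow> ('a, 'n) chart \<Rightarrow> real ^ 'n \<Rightarrow> real ^ 'n" where
  "transition c c' = snd c' \<circ> chart_inv c"

definition overlap :: "('a, 'n::finite) chart \<Rightarrow> ('a, 'n) chart \<Rightarrow> (real ^ 'n) set" where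
  "overlap c c' = snd c ` (fst c \<inter> fst c')"

definition smooth_atlas :: "('a::topological_space, 'n::finite) chart set \<Rightarrow> bool" where
  "smooth_atlas A \<longleftrightarrow>
     (\<forall>c\<in>A. open (fst c) \<and> open (chart_range c) \<and>
        homeomorphism (fst c) (chart_range c) (snd c) (chart_inv c)) \<and>
     (\<Union>c\<in>A. fst c) = UNIV \<and>
     (\<forall>c\<in>A. \<forall>c'\<in>A. smooth_on (overlap c c') (transition c c'))"

(* The atlas need not be maximal: it determines the smooth structure and the orientation. *)
definition oriented_atlas :: "('a::topological_space, 'n::finite) chart set \<Rightarrow> bool" where
  "oriented_atlas A \<longleftrightarrow> smooth_atlas A \<and>
     (\<forall>c\<in>A. \<forall>c'\<in>A. \<forall>t\<in>overlap c c'.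
        det (matrix (frechet_derivative (transition c c') (at t))) > 0)"

definition smooth_function :: "('a::topological_space, 'n::finite) chart set \<Rightarrow> ('a \<Rightarrow> complex) \<Rightarrow> bool" where
  "smooth_function A f \<longleftrightarrow> (\<forall>c\<in>A. smooth_on (chart_range c) (f \<circ> chart_inv c))"


section \<open>Complex differential forms\<close>

definition alternating_multilinear :: "nat \<Rightarrow> ('v::real_vector list \<Rightarrow> complex) \<Rightarrow> bool" where
  "alternating_multilinear q h \<longleftrightarrow>
     (\<forall>vs i. length vs = q \<and> i < q \<longrightarrow> linear (\<lambda>v. h (vs[i := v]))) \<and>
     (\<forall>vs i j. length vs = q \<and> i < j \<and> j < q \<and> vs ! i = vs ! j \<longrightarrow> h vs = 0)"

(* A form is the family of its local representatives: eta c t vs is the value, at the point with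
   coordinates t in the chart c, on the tangent vectors whose coordinates in c are listed in vs.
   Representatives in different charts are related by pullback along the transition map.
   Values outside the meaningful arguments are fixed to be 0, so that equality of forms
   is equality of functions. *)
type_synonym ('a, 'n) form = "('a, 'n) chart \<Rightarrow> real ^ 'n \<Rightarrow> (real ^ 'n) list \<Rightarrow> complex"

definition forms :: "('a::topological_space, 'n::finite) chart set \<Rightarrow> nat \<Rightarrow> ('a, 'n) form set" where
  "forms A q = {\<eta>.
     (\<forall>c t vs. \<not> (c \<in> A \<and> t \<in> chart_range c \<and> length vs = q) \<longrightarrow> \<eta> c t vs = 0) \<and>
     (\<forall>c\<in>A. \<forall>t\<in>chart_range c. alternating_multilinear q (\<eta> c t)) \<and>
     (\<forall>c\<in>A. \<forall>c'\<in>A. \<forall>t\<in>overlap c c'. \<forall>vs. length vs = q \<longrightarrow>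
        \<eta> c t vs = \<eta> c' (transition c c' t) (map (frechet_derivative (transition c c') (at t)) vs))}"

definition smooth_forms :: "('a::topological_space, 'n::finite) chart set \<Rightarrow> nat \<Rightarrow> ('a, 'n) form set" where
  "smooth_forms A q =
     {\<eta> \<in> forms A q. \<forall>c\<in>A. \<forall>vs. smooth_on (chart_range c) (\<lambda>t. \<eta> c t vs)}"

definition omit_nth :: "nat \<Rightarrow> 'v list \<Rightarrow> 'v list" where
  "omit_nth i vs = take i vs @ drop (Suc i) vs"

(* Exterior derivative; the vectors in vs are constant vector fields in the coordinates of c,
   so there are no bracket terms. *)
definition ext_d :: "('a, 'n::finite) chart set \<Rightarrow> ('a, 'n) form \<Rightarrow> ('a, 'n) form" where
  "ext_d A \<eta> = (\<lambda>c t vs. if c \<in> A \<and> t \<in> chart_range c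
     then \<Sum>i<length vs. (-1) ^ i * frechet_derivative (\<lambda>s. \<eta> c s (omit_nth i vs)) (at t) (vs ! i)
     else 0)"

(* Exterior product of a 1-form with a form of arbitrary degree. *)
definition wedge1 :: "('a, 'n) form \<Rightarrow> ('a, 'n::finite) form \<Rightarrow> ('a, 'n) form" where
  "wedge1 \<alpha> \<eta> = (\<lambda>c t vs. \<Sum>i<length vs. (-1) ^ i * \<alpha> c t [vs ! i] * \<eta> c t (omit_nth i vs))"

definition zero_form :: "('a, 'n::finite) chart set \<Rightarrow> ('a \<Rightarrow> complex) \<Rightarrow> ('a, 'n) form" where
  "zero_form A f = (\<lambda>c t vs. if c \<in> A \<and> t \<in> chart_range c \<and> vs = [] then f (chart_inv c t) else 0)"

definition fun_times_form :: "('a \<Rightarrow> complex) \<Rightarrow> ('a, 'n::finite) form \<Rightarrow> ('a, 'n) form" where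
  "fun_times_form f \<eta> = (\<lambda>c t vs. f (chart_inv c t) * \<eta> c t vs)"


section \<open>The torus\<close>

definition torus_rel :: "real ^ 'm \<Rightarrow> real ^ 'm::finite \<Rightarrow> bool" where
  "torus_rel x y \<longleftrightarrow> (\<exists>k :: int ^ 'm. \<forall>i. x $ i - y $ i = 2 * pi * of_int (k $ i))"

lemma equivp_torus_rel: "equivp torus_rel"
proof (rule equivpI)
  show "reflp torus_rel"
    unfolding reflp_def torus_rel_def by (auto intro!: exI[of _ 0])
  show "symp torus_rel"
    unfolding symp_def torus_rel_def
  proof clarify
    fix x y :: "real ^ 'm" and k :: "int ^ 'm"
    assume "\<forall>i. x $ i - y $ i = 2 * pi * of_int (k $ i)"
    then show "\<exists>k :: int ^ 'm. \<forall>i. y $ i - x $ i = 2 * pi * of_int (k $ i)"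
      by (intro exI[of _ "- k"]) (simp, smt (verit))
  qed
  show "transp torus_rel"
    unfolding transp_def torus_rel_def
  proof clarify
    fix x y z :: "real ^ 'm" and k l :: "int ^ 'm"
    assume "\<forall>i. x $ i - y $ i = 2 * pi * of_int (k $ i)" "\<forall>i. y $ i - z $ i = 2 * pi * of_int (l $ i)"
    then show "\<exists>k :: int ^ 'm. \<forall>i. x $ i - z $ i = 2 * pi * of_int (k $ i)"
      by (intro exI[of _ "k + l"]) (simp add: distrib_left, smt (verit))
  qed
qed

quotient_type 'm torus = "(real, 'm::finite) vec" / torus_rel
  morphisms rep_torus torus_class
  by (rule equivp_torus_rel)

lift_definition torus_shift :: "real ^ 'm \<Rightarrow> 'm::finite torus \<Rightarrow> 'm torus" is "\<lambda>x y. x + y"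
  by (simp add: torus_rel_def)


section \<open>The complex of the operator d' on the product of M with the torus\<close>

(* Sections of the pullback of the bundle of q-forms to the product, as families of q-forms on M
   indexed by the torus, smooth jointly in both variables. *)
type_synonym ('a, 'n, 'm) product_form = "'m torus \<Rightarrow> ('a, 'n) form"

definition smooth_sections ::
    "('a::topological_space, 'n::finite) chart set \<Rightarrow> nat \<Rightarrow> ('a, 'n, 'm::finite) product_form set" where
  "smooth_sections A q = {u. (\<forall>X. u X \<in> forms A q) \<and>
     (\<forall>c\<in>A. \<forall>vs. smooth_on (chart_range c \<times> UNIV) (\<lambda>(t, x). u (torus_class x) c t vs))}"

definition torus_partial :: "'m::finite \<Rightarrow> ('a, 'n, 'm) product_form \<Rightarrow> ('a, 'n::finite, 'm) product_form" where
  "torus_partial k u = (\<lambda>X c t vs.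
     vector_derivative (\<lambda>s::real. u (torus_shift (s *\<^sub>R axis k 1) X) c t vs) (at 0))"

definition dprime :: "('a, 'n::finite) chart set \<Rightarrow> ('m::finite \<Rightarrow> ('a, 'n) form) \<Rightarrow>
    ('a, 'n, 'm) product_form \<Rightarrow> ('a, 'n, 'm) product_form" where
  "dprime A \<omega> u = (\<lambda>X. ext_d A (u X) + (\<Sum>k\<in>UNIV. wedge1 (\<omega> k) (torus_partial k u X)))"

definition cocycles :: "('a::topological_space, 'n::finite) chart set \<Rightarrow> ('m::finite \<Rightarrow> ('a, 'n) form) \<Rightarrow>
    nat \<Rightarrow> ('a, 'n, 'm) product_form set" where
  "cocycles A \<omega> q = {u \<in> smooth_sections A q. dprime A \<omega> u = 0}"

definition coboundaries :: "('a::topological_space, 'n::finite) chart set \<Rightarrow> ('m::finite \<Rightarrow> ('a, 'n) form) \<Rightarrow>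
    nat \<Rightarrow> ('a, 'n, 'm) product_form set" where
  "coboundaries A \<omega> q = (case q of 0 \<Rightarrow> {0} | Suc p \<Rightarrow> dprime A \<omega> ` smooth_sections A p)"

definition cohomology :: "('a::topological_space, 'n::finite) chart set \<Rightarrow> ('m::finite \<Rightarrow> ('a, 'n) form) \<Rightarrow>
    nat \<Rightarrow> ('a, 'n, 'm) product_form set set" where
  "cohomology A \<omega> q = cocycles A \<omega> q //
     {(u, v). u \<in> cocycles A \<omega> q \<and> v \<in> cocycles A \<omega> q \<and> u - v \<in> coboundaries A \<omega> q}"

definition section_scale :: "complex \<Rightarrow> ('a, 'n::finite, 'm::finite) product_form \<Rightarrow> ('a, 'n, 'm) product_form" where
  "section_scale a u = (\<lambda>X c t vs. a * u X c t vs)"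

(* Complex linear independence of a finite set S of cohomology classes.  The linear combination
   of the classes C with coefficients a C is the class of the same combination of
   representatives r C, and it is zero iff the latter is a coboundary. *)
definition independent_classes :: "('a::topological_space, 'n::finite) chart set \<Rightarrow>
    ('m::finite \<Rightarrow> ('a, 'n) form) \<Rightarrow> nat \<Rightarrow> ('a, 'n, 'm) product_form set set \<Rightarrow> bool" where
  "independent_classes A \<omega> q S \<longleftrightarrow>
     (\<forall>r a. (\<forall>C\<in>S. r C \<in> C) \<and> (\<Sum>C\<in>S. section_scale (a C) (r C)) \<in> coboundaries A \<omega> q
        \<longrightarrow> (\<forall>C\<in>S. a C = 0))"

definition cohomology_dim :: "('a::topological_space, 'n::finite) chart set \<Rightarrow>
    ('m::finite \<Rightarrow> ('a, 'n) form) \<Rightarrow> nat \<Rightarrow> enat" where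
  "cohomology_dim A \<omega> q =
     Sup {enat (card S) | S. S \<subseteq> cohomology A \<omega> q \<and> finite S \<and> independent_classes A \<omega> q S}"


section \<open>The group associated with the forms\<close>

definition lin_comb_forms :: "int ^ 'm \<Rightarrow> ('m::finite \<Rightarrow> ('a, 'n::finite) form) \<Rightarrow> ('a, 'n) form" where
  "lin_comb_forms \<xi> \<omega> = (\<lambda>c t vs. \<Sum>k\<in>UNIV. of_int (\<xi> $ k) * \<omega> k c t vs)"

definition Gamma_group :: "('a::topological_space, 'n::finite) chart set \<Rightarrow>
    ('m::finite \<Rightarrow> ('a, 'n) form) \<Rightarrow> (int ^ 'm) set" where
  "Gamma_group A \<omega> = {\<xi>. \<exists>f. smooth_function A f \<and> (\<exists>p. f p \<noteq> 0) \<and>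
     ext_d A (zero_form A f) + fun_times_form (\<lambda>p. \<i> * f p) (lin_comb_forms \<xi> \<omega>) = 0}"

end

theory Submission
  imports Defs "HOL-Computational_Algebra.Fundamental_Theorem_Algebra"
begin

text \<open>
Suppose that \<open>\<xi> \<noteq> 0\<close> belongs to the group, and let \<open>f\<close> satisfy \<open>df + i f (\<xi> \<cdot> \<omega>) = 0\<close>. In charts this is
a linear equation \<open>f' = f h\<close>, so on a connected manifold a solution that is not identically zero
vanishes nowhere (\<open>flat_function_nonzero\<close>), and \<open>1/f\<close> solves the equation for \<open>- \<xi>\<close>.
The function \<open>F = f(t) exp (i \<xi> \<cdot> x)\<close> on the product is then invertible and annihilated by \<open>d'\<close>, so
multiplication \<open>M\<close> by \<open>F\<close> is an automorphism of the complex (\<open>dprime_char_multiply_add\<close>). The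
translation \<open>T\<close> by a vector \<open>y\<close> of the torus is another one, and \<open>T M = c M T\<close> with
\<open>c = exp (i \<xi> \<cdot> y)\<close>.

Both act on the cohomology as invertible operators. If the cohomology is finite-dimensional and nonzero,
\<open>T\<close> has an eigenvector there, and \<open>M\<close> multiplies its eigenvalue by \<open>c\<close>. Since \<open>\<xi> \<noteq> 0\<close>, the number \<open>c\<close>
can be made a primitive root of unity of any order \<open>n\<close>; this produces \<open>n\<close> distinct eigenvalues and
contradicts finiteness for large \<open>n\<close> (\<open>independent_mod_twisted_commuting\<close>,
\<open>cohomology_dim_infinite\<close>). Conversely, constants show that \<open>0\<close> always belongs to the group.

All linear algebra takes place modulo the space of coboundaries, which has to be a subspace stable under
\<open>T\<close>, \<open>M\<close> and their inverses.
\<close>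

section \<open>Calculus of smooth maps\<close>

lemma Ck_on_cong:
  assumes "open S" and "\<And>x. x \<in> S \<Longrightarrow> f x = g x" and "Ck_on k S f"
  shows "Ck_on k S g"
  using assms(2,3)
proof (induction k arbitrary: f g)
  case 0
  then show ?case by (simp cong: continuous_on_cong)
next
  case (Suc k)
  have d: "f differentiable (at x)" if "x \<in> S" for x using Suc.prems(2) that by simp
  have "g differentiable (at x)" if "x \<in> S" for x
    using d[OF that] has_derivative_transform_within_open[OF _ assms(1) that, of f _ UNIV g] Suc.prems(1)
    unfolding differentiable_def by blast
  moreover have "Ck_on k S (\<lambda>x. frechet_derivative g (at x) v)" for v
  proof (rule Suc.IH)
    show "frechet_derivative f (at x) v = frechet_derivative g (at x) v" if "x \<in> S" for x
      using frechet_derivative_transform_within_open[OF d[OF that] assms(1) that Suc.prems(1)] by simp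
    show "Ck_on k S (\<lambda>x. frechet_derivative f (at x) v)" using Suc.prems(2) by simp
  qed
  ultimately show ?case by simp
qed

lemma Ck_on_SucI:
  assumes "open S" and d: "\<And>x. x \<in> S \<Longrightarrow> (f has_derivative f' x) (at x)"
    and "\<And>v. Ck_on k S (\<lambda>x. f' x v)"
  shows "Ck_on (Suc k) S f"
proof -
  have "f differentiable (at x)" if "x \<in> S" for x
    using d[OF that] unfolding differentiable_def by blast
  moreover have "Ck_on k S (\<lambda>x. frechet_derivative f (at x) v)" for v
    by (rule Ck_on_cong[OF assms(1) _ assms(3)[of v]])
       (use d frechet_derivative_at in fastforce)
  ultimately show ?thesis by simp
qed

lemma Ck_on_SucD: "Ck_on (Suc k) S f \<Longrightarrow> Ck_on k S f"
proof (induction k arbitrary: f)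
  case 0
  then show ?case
    by (auto intro!: continuous_at_imp_continuous_on differentiable_imp_continuous_within)
next
  case (Suc k)
  have "Ck_on k S (\<lambda>x. frechet_derivative f (at x) v)" for v
    using Suc.prems by (intro Suc.IH) simp
  then show ?case using Suc.prems by simp
qed

lemma Ck_on_has_derivative:
  "Ck_on (Suc k) S f \<Longrightarrow> x \<in> S \<Longrightarrow> (f has_derivative frechet_derivative f (at x)) (at x)"
  by (simp add: frechet_derivative_works)

lemma Ck_on_const: "open S \<Longrightarrow> Ck_on k S (\<lambda>x. c)"
proof (induction k arbitrary: c)
  case (Suc k)
  then show ?case by (intro Ck_on_SucI[where f'="\<lambda>x v. 0"]) auto
qed simp

lemma Ck_on_add:
  "open S \<Longrightarrow> Ck_on k S f \<Longrightarrow> Ck_on k S g \<Longrightarrow> Ck_on k S (\<lambda>x. f x + g x)"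
proof (induction k arbitrary: f g)
  case 0
  then show ?case by (auto intro: continuous_intros)
next
  case (Suc k)
  show ?case
    by (rule Ck_on_SucI[OF Suc.prems(1)
          has_derivative_add[OF Ck_on_has_derivative[OF Suc.prems(2)] Ck_on_has_derivative[OF Suc.prems(3)]]])
       (use Suc in simp_all)
qed

lemma Ck_on_mult:
  fixes f g :: "'e::real_normed_vector \<Rightarrow> 'f::real_normed_algebra"
  shows "open S \<Longrightarrow> Ck_on k S f \<Longrightarrow> Ck_on k S g \<Longrightarrow> Ck_on k S (\<lambda>x. f x * g x)"
proof (induction k arbitrary: f g)
  case 0
  then show ?case by (auto intro: continuous_intros)
next
  case (Suc k)
  show ?case
    by (rule Ck_on_SucI[OF Suc.prems(1)
          has_derivative_mult[OF Ck_on_has_derivative[OF Suc.prems(2)] Ck_on_has_derivative[OF Suc.prems(3)]]],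
        assumption, assumption, intro Ck_on_add Suc.IH)
       (use Suc.prems Ck_on_SucD[OF Suc.prems(2)] Ck_on_SucD[OF Suc.prems(3)] in simp_all)
qed

lemma Ck_on_compose_affine:
  assumes "bounded_linear L" and "open S'"
  shows "Ck_on k S f \<Longrightarrow> (\<And>x. x \<in> S' \<Longrightarrow> L x + a \<in> S) \<Longrightarrow> Ck_on k S' (\<lambda>x. f (L x + a))"
proof (induction k arbitrary: f)
  case 0
  have "continuous_on S' (\<lambda>x. L x + a)"
    by (intro continuous_intros linear_continuous_on assms)
  from continuous_on_compose2[OF _ this, of S f] 0 show ?case by auto
next
  case (Suc k)
  have L: "((\<lambda>x. L x + a) has_derivative L) (at x)" for x
    using has_derivative_add[OF bounded_linear_imp_has_derivative[OF assms(1)] has_derivative_const] by simp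
  show ?case
  proof (rule Ck_on_SucI[OF assms(2)])
    show "((\<lambda>x. f (L x + a)) has_derivative (\<lambda>v. frechet_derivative f (at (L x + a)) (L v))) (at x)"
      if "x \<in> S'" for x
      using has_derivative_compose[OF L Ck_on_has_derivative[OF Suc.prems(1) Suc.prems(2)[OF that]]] .
    show "Ck_on k S' (\<lambda>x. frechet_derivative f (at (L x + a)) (L v))" for v
      using Suc by (intro Suc.IH) simp_all
  qed
qed

lemma smooth_on_const: "open S \<Longrightarrow> smooth_on S (\<lambda>x. c)"
  by (simp add: smooth_on_def Ck_on_const)

lemma smooth_on_add:
  "open S \<Longrightarrow> smooth_on S f \<Longrightarrow> smooth_on S g \<Longrightarrow> smooth_on S (\<lambda>x. f x + g x)"
  by (simp add: smooth_on_def Ck_on_add)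

lemma smooth_on_mult:
  fixes f g :: "'e::real_normed_vector \<Rightarrow> 'f::real_normed_algebra"
  shows "open S \<Longrightarrow> smooth_on S f \<Longrightarrow> smooth_on S g \<Longrightarrow> smooth_on S (\<lambda>x. f x * g x)"
  by (simp add: smooth_on_def Ck_on_mult)

lemma smooth_on_sum:
  assumes "open S" and "\<And>i. i \<in> I \<Longrightarrow> smooth_on S (f i)"
  shows "smooth_on S (\<lambda>x. \<Sum>i\<in>I. f i x)"
  using assms(2)
  by (induction I rule: infinite_finite_induct) (auto intro: assms(1) smooth_on_const smooth_on_add)

lemma smooth_on_compose_affine:
  assumes "bounded_linear L" and "open S'" and "smooth_on S f" and "\<And>x. x \<in> S' \<Longrightarrow> L x + a \<in> S"
  shows "smooth_on S' (\<lambda>x. f (L x + a))"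
  using assms Ck_on_compose_affine unfolding smooth_on_def by blast

lemma smooth_on_imp_differentiable: "smooth_on S f \<Longrightarrow> x \<in> S \<Longrightarrow> f differentiable (at x)"
  unfolding smooth_on_def using Ck_on.simps(2) by blast

lemma smooth_on_imp_continuous_on: "smooth_on S f \<Longrightarrow> continuous_on S f"
  unfolding smooth_on_def using Ck_on.simps(1) by blast

text \<open>Bootstrapping: in \<open>F' = F h\<close> with \<open>h\<close> smooth, the right-hand side is as regular as \<open>F\<close>, so each
order of differentiability yields the next. Flat functions, their inverses and characters all satisfy
equations of this form.\<close>
lemma smooth_on_log_derivative:
  fixes F :: "'e::real_normed_vector \<Rightarrow> complex"
  assumes "open S" and "\<And>x. x \<in> S \<Longrightarrow> (F has_derivative (\<lambda>v. F x * h v x)) (at x)"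
    and "\<And>v. smooth_on S (h v)"
  shows "smooth_on S F"
  unfolding smooth_on_def
proof
  fix k
  show "Ck_on k S F"
  proof (induction k)
    case 0
    show ?case
      using assms(2) by (auto intro!: continuous_at_imp_continuous_on has_derivative_continuous)
  next
    case (Suc k)
    show ?case
      using assms(3) by (intro Ck_on_SucI[OF assms(1,2)] Ck_on_mult[OF assms(1) Suc]) (auto simp: smooth_on_def)
  qed
qed

text \<open>Uniqueness for the linear equation \<open>y' = y h\<close>. Near a zero \<open>t0\<close>, let \<open>m\<close> be the maximum of \<open>|y|\<close> on a
ball of radius \<open>\<delta>\<close>, and let \<open>L\<close> bound \<open>h\<close> there. The mean value inequality gives \<open>m \<le> L m \<delta>\<close>, hence
\<open>m = 0\<close> as soon as \<open>L \<delta> < 1\<close>.\<close>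
lemma open_zeros_log_derivative:
  fixes y :: "'e::euclidean_space \<Rightarrow> complex"
  assumes S: "open S" and d: "\<And>t. t \<in> S \<Longrightarrow> (y has_derivative (\<lambda>v. y t * h v t)) (at t)"
    and h: "\<And>v. continuous_on S (h v)"
  shows "open {t \<in> S. y t = 0}"
proof (unfold open_contains_ball, intro ballI)
  fix t0 assume "t0 \<in> {t \<in> S. y t = 0}"
  then have t0: "t0 \<in> S" "y t0 = 0" by auto
  obtain r where r: "r > 0" "cball t0 r \<subseteq> S" using S t0 open_contains_cball by blast
  \<comment> \<open>Bounds the operator norm of \<open>v \<mapsto> h v t\<close>, and is visibly continuous in \<open>t\<close>.\<close>
  let ?G = "\<lambda>t. \<Sum>b\<in>Basis. norm (h b t)"
  have "continuous_on (cball t0 r) ?G"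
    using h r by (intro continuous_intros) (auto intro: continuous_on_subset)
  then have "bounded (?G ` cball t0 r)"
    by (intro compact_imp_bounded compact_continuous_image compact_cball)
  then obtain L where L0: "L > 0" and LG: "\<forall>x\<in>?G ` cball t0 r. norm x \<le> L"
    unfolding bounded_pos by blast
  have "?G t \<le> L" if "t \<in> cball t0 r" for t
    using LG that abs_le_D1[of "?G t" L] by auto
  note L = L0 this
  define \<delta> where "\<delta> = min r (1 / (2 * L))"
  have \<delta>: "\<delta> > 0" "\<delta> \<le> r" "L * \<delta> \<le> 1 / 2"
    using r L by (auto simp: \<delta>_def min_def field_simps)
  have sub: "cball t0 \<delta> \<subseteq> cball t0 r" using \<delta> by auto
  have y: "continuous_on (cball t0 \<delta>) y"
    using d r sub by (intro continuous_at_imp_continuous_on ballI has_derivative_continuous) blast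
  obtain t1 where t1: "t1 \<in> cball t0 \<delta>" "\<And>t. t \<in> cball t0 \<delta> \<Longrightarrow> norm (y t) \<le> norm (y t1)"
    using continuous_attains_sup[of "cball t0 \<delta>" "\<lambda>t. norm (y t)"] \<delta> continuous_on_norm[OF y] by auto
  have bound: "onorm (\<lambda>v. y t * h v t) \<le> L * norm (y t1)" if t: "t \<in> cball t0 \<delta>" for t
  proof (rule onorm_le)
    fix v
    have "t \<in> S" using t sub r by auto
    then have lin: "linear (\<lambda>v. y t * h v t)" using d has_derivative_linear by blast
    have "norm (y t * h v t) = norm (\<Sum>b\<in>Basis. (v \<bullet> b) *\<^sub>R (y t * h b t))"
      using linear_sum[OF lin, of "\<lambda>b. (v \<bullet> b) *\<^sub>R b" Basis] linear_scale[OF lin]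
      by (simp add: euclidean_representation)
    also have "\<dots> \<le> (\<Sum>b\<in>Basis. norm v * (norm (y t1) * norm (h b t)))"
    proof (rule order_trans[OF norm_sum], rule sum_mono)
      fix b :: 'e assume b: "b \<in> Basis"
      show "norm ((v \<bullet> b) *\<^sub>R (y t * h b t)) \<le> norm v * (norm (y t1) * norm (h b t))"
        unfolding norm_scaleR norm_mult
        by (intro mult_mono Basis_le_norm b t1 t) auto
    qed
    also have "\<dots> = norm v * norm (y t1) * ?G t" by (simp add: sum_distrib_left mult.assoc)
    also have "\<dots> \<le> norm v * norm (y t1) * L" using L(2) t sub by (intro mult_left_mono) auto
    finally show "norm (y t * h v t) \<le> L * norm (y t1) * norm v" by (simp add: mult_ac)
  qed
  have "norm (y t1 - y t0) \<le> L * norm (y t1) * norm (t1 - t0)"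
  proof (rule differentiable_bound[of "cball t0 \<delta>" y "\<lambda>t v. y t * h v t"])
    show "(y has_derivative (\<lambda>v. y t * h v t)) (at t within cball t0 \<delta>)" if "t \<in> cball t0 \<delta>" for t
      by (rule has_derivative_at_withinI, rule d) (use that sub r in auto)
    show "t0 \<in> cball t0 \<delta>" using \<delta>(1) by simp
  qed (rule convex_cball bound t1(1), assumption?)+
  also have "\<dots> \<le> L * norm (y t1) * \<delta>"
    using t1(1) L by (intro mult_left_mono) (auto simp: dist_norm norm_minus_commute)
  also have "\<dots> = (L * \<delta>) * norm (y t1)" by simp
  also have "\<dots> \<le> 1 / 2 * norm (y t1)" by (intro mult_right_mono \<delta>) auto
  finally have "norm (y t1) = 0" using t0 by simp
  then have "y t = 0" if "t \<in> cball t0 \<delta>" for t using t1(2)[OF that] by simp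
  then have "ball t0 \<delta> \<subseteq> {t \<in> S. y t = 0}" using sub r by fastforce
  then show "\<exists>e>0. ball t0 e \<subseteq> {t \<in> S. y t = 0}" using \<delta> by blast
qed

section \<open>Linear algebra modulo a subspace\<close>

text \<open>Linear independence of the images in the quotient by \<open>B\<close>. The index set is a segment of the natural
numbers, so that repetitions count as dependences.\<close>
definition (in vector_space) independent_mod :: "'b set \<Rightarrow> nat \<Rightarrow> (nat \<Rightarrow> 'b) \<Rightarrow> bool" where
  "independent_mod B n w \<longleftrightarrow> (\<forall>a. (\<Sum>k<n. scale (a k) (w k)) \<in> B \<longrightarrow> (\<forall>k<n. a k = 0))"

text \<open>The classical argument for eigenvectors with distinct eigenvalues, carried out modulo \<open>B\<close>: applying
\<open>T - \<mu> n\<close> to a relation removes its last term.\<close>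
lemma (in vector_space) independent_mod_eigenvectors:
  assumes B: "subspace B" and T: "Vector_Spaces.linear scale scale T"
    and TB: "\<And>u. u \<in> B \<Longrightarrow> T u \<in> B"
    and eig: "\<And>k. k < n \<Longrightarrow> T (w k) - scale (\<mu> k) (w k) \<in> B"
    and w: "\<And>k. k < n \<Longrightarrow> w k \<notin> B" and inj: "inj_on \<mu> {..<n}"
  shows "independent_mod B n w"
  using eig w inj
proof (induction n)
  case 0
  show ?case by (simp add: independent_mod_def)
next
  case (Suc n)
  interpret T: Vector_Spaces.linear scale scale T by (rule T)
  have IH: "independent_mod B n w"
    using Suc.prems by (intro Suc.IH) (auto simp: lessThan_Suc)
  show ?case
    unfolding independent_mod_def
  proof (intro allI impI)
    fix a k assume a: "(\<Sum>k<Suc n. scale (a k) (w k)) \<in> B" and k: "k < Suc n"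
    let ?s = "\<Sum>k<Suc n. scale (a k) (w k)"
    let ?e = "\<lambda>k. T (w k) - scale (\<mu> k) (w k)"
    have "(\<Sum>k<n. scale (a k * (\<mu> k - \<mu> n)) (w k)) = (\<Sum>k<Suc n. scale (a k * (\<mu> k - \<mu> n)) (w k))"
      by simp
    also have "\<dots> = (\<Sum>k<Suc n. scale (a k) (T (w k)) - scale (\<mu> n) (scale (a k) (w k)) - scale (a k) (?e k))"
      by (intro sum.cong refl) (simp add: algebra_simps)
    also have "\<dots> = T ?s - scale (\<mu> n) ?s - (\<Sum>k<Suc n. scale (a k) (?e k))"
      unfolding sum_subtractf scale_sum_right T.sum T.scale ..
    also have "\<dots> \<in> B"
    proof -
      have "(\<Sum>k<Suc n. scale (a k) (?e k)) \<in> B"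
        using Suc.prems(1) by (intro subspace_sum[OF B] subspace_scale[OF B]) simp
      then show ?thesis
        using subspace_diff[OF B subspace_diff[OF B TB[OF a] subspace_scale[OF B a]]] by blast
    qed
    finally have "\<forall>k<n. a k * (\<mu> k - \<mu> n) = 0"
      using IH[unfolded independent_mod_def, rule_format, of "\<lambda>k. a k * (\<mu> k - \<mu> n)"] by blast
    moreover have "\<mu> k \<noteq> \<mu> n" if "k < n" for k
      using Suc.prems(3) that by (auto simp: inj_on_def)
    ultimately have z: "\<forall>k<n. a k = 0" by auto
    then have "scale (a n) (w n) \<in> B" using a by simp
    then have "a n = 0"
      using subspace_scale[OF B, of "scale (a n) (w n)" "inverse (a n)"] Suc.prems(2)[of n]
      by (cases "a n = 0") simp_all
    then show "a k = 0" using z k less_Suc_eq by auto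
  qed
qed

definition (in vector_space) poly_apply :: "('b \<Rightarrow> 'b) \<Rightarrow> 'b \<Rightarrow> 'a poly \<Rightarrow> 'b" where
  "poly_apply T u p = (\<Sum>i\<le>degree p. scale (coeff p i) ((T ^^ i) u))"

lemma (in vector_space) poly_apply_bound:
  assumes "degree p \<le> n"
  shows "poly_apply T u p = (\<Sum>i\<le>n. scale (coeff p i) ((T ^^ i) u))"
  unfolding poly_apply_def
  by (rule sum.mono_neutral_left) (use assms in \<open>auto simp: coeff_eq_0\<close>)

lemma (in vector_space) poly_apply_linear_factor:
  assumes "Vector_Spaces.linear scale scale T"
  shows "poly_apply T u ([:- \<nu>, 1:] * q) = T (poly_apply T u q) - scale \<nu> (poly_apply T u q)"
proof -
  interpret T: Vector_Spaces.linear scale scale T by (rule assms)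
  let ?n = "degree q"
  have eq: "[:- \<nu>, 1:] * q = pCons 0 q - smult \<nu> q" by simp
  have "degree ([:- \<nu>, 1:] * q) \<le> Suc ?n"
    using degree_mult_le[of "[:- \<nu>, 1:]" q] by simp
  note bound = poly_apply_bound[OF this, of T u]
  have "poly_apply T u ([:- \<nu>, 1:] * q)
      = (\<Sum>i\<le>Suc ?n. scale (coeff (pCons 0 q) i) ((T ^^ i) u)) - scale \<nu> (\<Sum>i\<le>Suc ?n. scale (coeff q i) ((T ^^ i) u))"
    unfolding bound unfolding eq
    by (simp add: scale_sum_right scale_left_diff_distrib sum_subtractf del: sum.atMost_Suc)
  also have "(\<Sum>i\<le>Suc ?n. scale (coeff q i) ((T ^^ i) u)) = poly_apply T u q"
    by (rule poly_apply_bound[symmetric]) simp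
  also have "(\<Sum>i\<le>Suc ?n. scale (coeff (pCons 0 q) i) ((T ^^ i) u)) = T (poly_apply T u q)"
    unfolding sum.atMost_Suc_shift poly_apply_def by (simp add: T.sum T.scale)
  finally show ?thesis .
qed

text \<open>Choose \<open>p\<close> of least degree among the nonzero polynomials with \<open>p(T) u \<in> B\<close>; the assumed dependence
provides one. Over the complex numbers \<open>p\<close> has a root \<open>\<nu>\<close>, and with \<open>p = (X - \<nu>) q\<close> the vector \<open>q(T) u\<close>
is an eigenvector for \<open>\<nu>\<close> which, by minimality, does not lie in \<open>B\<close>.\<close>
lemma eigenvector_mod_subspace:
  fixes scale :: "complex \<Rightarrow> 'b::ab_group_add \<Rightarrow> 'b"
  assumes "vector_space scale" and B: "module.subspace scale B" and Z: "module.subspace scale Z"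
    and T: "Vector_Spaces.linear scale scale T"
    and TZ: "\<And>u. u \<in> Z \<Longrightarrow> T u \<in> Z" and u: "u \<in> Z" "u \<notin> B"
    and dep: "\<not> vector_space.independent_mod scale B n (\<lambda>k. (T ^^ k) u)"
  shows "\<exists>v \<nu>. v \<in> Z \<and> v \<notin> B \<and> T v - scale \<nu> v \<in> B"
proof -
  interpret vector_space scale by (rule assms)
  interpret T: Vector_Spaces.linear scale scale T by (rule T)
  obtain a j where a: "(\<Sum>k<n. scale (a k) ((T ^^ k) u)) \<in> B" "j < n" "a j \<noteq> 0"
    using dep unfolding independent_mod_def by blast
  define P where "P p \<longleftrightarrow> p \<noteq> 0 \<and> poly_apply T u p \<in> B" for p
  let ?p = "Poly (map a [0..<n])"
  have cf: "coeff ?p i = (if i < n then a i else 0)" for i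
    by (simp add: coeff_Poly_eq nth_default_def)
  have "degree ?p \<le> n"
    by (rule degree_le) (use cf in auto)
  then have "poly_apply T u ?p = (\<Sum>k\<le>n. scale (coeff ?p k) ((T ^^ k) u))"
    by (rule poly_apply_bound)
  also have "\<dots> = (\<Sum>k<n. scale (a k) ((T ^^ k) u))"
    unfolding lessThan_Suc_atMost[symmetric] sum.lessThan_Suc cf by simp
  finally have "poly_apply T u ?p \<in> B" using a by simp
  moreover have "?p \<noteq> 0"
  proof
    assume "?p = 0"
    then have "coeff ?p j = 0" by (simp only: coeff_0)
    then show False using cf[of j] a by simp
  qed
  ultimately have "P ?p" unfolding P_def by blast
  then obtain p where p: "P p" "\<And>q. P q \<Longrightarrow> degree p \<le> degree q"
    using ex_has_least_nat[of P ?p degree] by blast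
  \<comment> \<open>A nonzero constant would put \<open>u\<close> itself into \<open>B\<close>.\<close>
  have "degree p \<noteq> 0"
  proof
    assume "degree p = 0"
    then obtain b where b: "p = [:b:]" by (rule degree_eq_zeroE)
    then have "b \<noteq> 0" "scale b u \<in> B" using p(1) by (auto simp: P_def poly_apply_def)
    then show False using subspace_scale[OF B, of "scale b u" "inverse b"] u by simp
  qed
  then obtain \<nu> where "poly p \<nu> = 0"
    using fundamental_theorem_of_algebra[of p] by (auto simp: constant_degree)
  then obtain q where q: "p = [:- \<nu>, 1:] * q" unfolding poly_eq_0_iff_dvd by (auto elim: dvdE)
  let ?v = "poly_apply T u q"
  have q0: "q \<noteq> 0" using p(1) q by (auto simp: P_def)
  then have "degree p = Suc (degree q)" unfolding q by (subst degree_mult_eq) auto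
  then have "\<not> P q" using p(2)[of q] by auto
  then have "?v \<notin> B" using q0 by (simp add: P_def)
  moreover have "T ?v - scale \<nu> ?v \<in> B"
    using p(1) poly_apply_linear_factor[OF T, of u \<nu> q] q by (simp add: P_def)
  moreover have "(T ^^ i) u \<in> Z" for i by (induction i) (auto intro: u TZ)
  then have "?v \<in> Z"
    unfolding poly_apply_def by (intro subspace_sum[OF Z] subspace_scale[OF Z])
  ultimately show ?thesis by blast
qed

text \<open>If \<open>T\<close> and \<open>M\<close> are injective modulo \<open>B\<close> and \<open>T M = c M T\<close>, then \<open>M\<close> maps eigenvectors of \<open>T\<close> with
eigenvalue \<open>\<nu>\<close> to eigenvectors with eigenvalue \<open>c \<nu>\<close>. Either the powers of \<open>T\<close> applied to \<open>u\<close> are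
already independent, or \<open>T\<close> has an eigenvector, whose images under the powers of \<open>M\<close> are independent
because \<open>\<nu>, c \<nu>, c\<^sup>2 \<nu>, \<dots>\<close> are distinct.\<close>
lemma independent_mod_twisted_commuting:
  fixes scale :: "complex \<Rightarrow> 'b::ab_group_add \<Rightarrow> 'b"
  assumes V: "vector_space scale" and B: "module.subspace scale B" and Z: "module.subspace scale Z"
    and T: "Vector_Spaces.linear scale scale T" and M: "Vector_Spaces.linear scale scale M"
    and TZ: "\<And>u. u \<in> Z \<Longrightarrow> T u \<in> Z" and MZ: "\<And>u. u \<in> Z \<Longrightarrow> M u \<in> Z"
    and TB: "\<And>u. T u \<in> B \<longleftrightarrow> u \<in> B" and MB: "\<And>u. M u \<in> B \<longleftrightarrow> u \<in> B"
    and TM: "\<And>u. T (M u) = scale c (M (T u))"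
    and c: "inj_on (\<lambda>k. c ^ k) {..<n}" and u: "u \<in> Z" "u \<notin> B"
  shows "\<exists>w. (\<forall>k. w k \<in> Z) \<and> vector_space.independent_mod scale B n w"
proof (cases "vector_space.independent_mod scale B n (\<lambda>k. (T ^^ k) u)")
  case True
  moreover have "(T ^^ k) u \<in> Z" for k by (induction k) (auto intro: u TZ)
  ultimately show ?thesis by (intro exI[of _ "\<lambda>k. (T ^^ k) u"]) simp
next
  case False
  interpret vector_space scale by (rule V)
  interpret T: Vector_Spaces.linear scale scale T by (rule T)
  interpret M: Vector_Spaces.linear scale scale M by (rule M)
  obtain v \<nu> where v: "v \<in> Z" "v \<notin> B" "T v - scale \<nu> v \<in> B"
    using eigenvector_mod_subspace[OF V B Z T TZ u False] by blast
  \<comment> \<open>Needed for the numbers \<open>\<nu> * c ^ k\<close> to be distinct.\<close>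
  have "\<nu> \<noteq> 0" using v(2,3) TB[of v] by auto
  let ?w = "\<lambda>k. (M ^^ k) v"
  have w: "?w k \<in> Z" "?w k \<notin> B" for k by (induction k) (use v in \<open>auto simp: MB intro: MZ\<close>)
  have eig: "T (?w k) - scale (\<nu> * c ^ k) (?w k) \<in> B" for k
  proof (induction k)
    case 0
    then show ?case using v by simp
  next
    case (Suc k)
    have "T (?w (Suc k)) - scale (\<nu> * c ^ Suc k) (?w (Suc k))
        = scale c (M (T (?w k) - scale (\<nu> * c ^ k) (?w k)))"
      by (simp add: TM M.diff M.scale scale_right_diff_distrib mult_ac)
    then show ?case using Suc MB subspace_scale[OF B] by simp
  qed
  have "inj_on (\<lambda>k. \<nu> * c ^ k) {..<n}" using c \<open>\<nu> \<noteq> 0\<close> by (auto simp: inj_on_def)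
  then have "independent_mod B n ?w"
    using eig w TB by (intro independent_mod_eigenvectors[OF B T, where \<mu>="\<lambda>k. \<nu> * c ^ k"]) auto
  then show ?thesis using w(1) by (intro exI[of _ ?w]) simp
qed

section \<open>Flat functions on the manifold\<close>

lemma chart_inv_chart:
  "smooth_atlas A \<Longrightarrow> c \<in> A \<Longrightarrow> p \<in> fst c \<Longrightarrow> chart_inv c (snd c p) = p"
  unfolding smooth_atlas_def by (simp add: homeomorphism_def)

lemma open_chart_range: "smooth_atlas A \<Longrightarrow> c \<in> A \<Longrightarrow> open (chart_range c)"
  by (simp add: smooth_atlas_def)

lemma chart_inv_transition:
  assumes "smooth_atlas A" "c \<in> A" "c' \<in> A" "t \<in> overlap c c'"
  shows "chart_inv c' (transition c c' t) = chart_inv c t"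
proof -
  obtain p where "p \<in> fst c" "p \<in> fst c'" "t = snd c p"
    using assms(4) by (auto simp: overlap_def)
  then show ?thesis
    using chart_inv_chart[OF assms(1)] assms(2,3) by (simp add: transition_def)
qed

lemma open_if_open_in_charts:
  fixes A :: "('a::topological_space, 'n::finite) chart set"
  assumes A: "smooth_atlas A" and "\<And>c. c \<in> A \<Longrightarrow> open {t \<in> chart_range c. P (chart_inv c t)}"
  shows "open {p. P p}"
proof -
  have "{p. P p} = (\<Union>c\<in>A. snd c -` {t \<in> chart_range c. P (chart_inv c t)} \<inter> fst c)"
  proof (intro equalityI subsetI)
    fix p assume p: "p \<in> {p. P p}"
    have "(\<Union>c\<in>A. fst c) = UNIV" using A by (simp add: smooth_atlas_def)
    then obtain c where "c \<in> A" "p \<in> fst c" by blast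
    then show "p \<in> (\<Union>c\<in>A. snd c -` {t \<in> chart_range c. P (chart_inv c t)} \<inter> fst c)"
      using p chart_inv_chart[OF A, of c p] by (intro UN_I[of c]) (auto simp: chart_range_def)
  qed (use chart_inv_chart[OF A] in auto)
  moreover have "open (snd c -` {t \<in> chart_range c. P (chart_inv c t)} \<inter> fst c)" if "c \<in> A" for c
  proof -
    have "continuous_on (fst c) (snd c)" "open (fst c)"
      using A that by (auto simp: smooth_atlas_def homeomorphism_def)
    then show ?thesis
      using continuous_on_open_vimage[THEN iffD1, rule_format] assms(2)[OF that] by blast
  qed
  ultimately show ?thesis by auto
qed

text \<open>The equation \<open>df + i f (\<xi> \<cdot> \<omega>) = 0\<close> in charts. It is written as \<open>f\<close> times a linear form so that it has
the shape \<open>F' = F h\<close> treated above; for smooth \<open>\<omega>\<close> the smoothness of \<open>f\<close> is then a consequence.\<close>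
definition flat_function ::
    "('a::topological_space, 'n::finite) chart set \<Rightarrow> ('m::finite \<Rightarrow> ('a, 'n) form) \<Rightarrow> int ^ 'm \<Rightarrow>
      ('a \<Rightarrow> complex) \<Rightarrow> bool" where
  "flat_function A \<omega> \<xi> g \<longleftrightarrow> (\<forall>c\<in>A. \<forall>t\<in>chart_range c.
     ((\<lambda>s. g (chart_inv c s)) has_derivative
       (\<lambda>v. g (chart_inv c t) * (- \<i> * lin_comb_forms \<xi> \<omega> c t [v]))) (at t))"

lemma smooth_lin_comb_forms:
  assumes "smooth_atlas A" "\<And>k. \<omega> k \<in> smooth_forms A 1" "c \<in> A"
  shows "smooth_on (chart_range c) (\<lambda>t. lin_comb_forms \<xi> \<omega> c t vs)"
  unfolding lin_comb_forms_def
  using assms open_chart_range[OF assms(1,3)]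
  by (intro smooth_on_sum smooth_on_mult smooth_on_const) (auto simp: smooth_forms_def)

lemma Gamma_group_flat_function:
  assumes A: "smooth_atlas A" and "\<xi> \<in> Gamma_group A \<omega>"
  obtains f p where "flat_function A \<omega> \<xi> f" "f p \<noteq> 0"
proof -
  obtain f p where f: "smooth_function A f" "f p \<noteq> 0"
    and eq: "ext_d A (zero_form A f) + fun_times_form (\<lambda>p. \<i> * f p) (lin_comb_forms \<xi> \<omega>) = 0"
    using assms(2) by (auto simp: Gamma_group_def)
  have "flat_function A \<omega> \<xi> f"
    unfolding flat_function_def
  proof (intro ballI)
    fix c t assume c: "c \<in> A" and t: "t \<in> chart_range c"
    let ?f = "\<lambda>s. f (chart_inv c s)"
    have d: "?f differentiable (at t)"
      using f(1) c t smooth_on_imp_differentiable[of "chart_range c" "f \<circ> chart_inv c" t]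
      by (auto simp: smooth_function_def comp_def)
    have "frechet_derivative ?f (at t) v = ?f t * (- \<i> * lin_comb_forms \<xi> \<omega> c t [v])" for v
    proof -
      have "frechet_derivative ?f (at t) = frechet_derivative (\<lambda>s. zero_form A f c s []) (at t)"
        by (rule frechet_derivative_transform_within_open[OF d open_chart_range[OF A c] t])
           (simp add: zero_form_def c)
      moreover have "frechet_derivative (\<lambda>s. zero_form A f c s []) (at t) v
          + \<i> * ?f t * lin_comb_forms \<xi> \<omega> c t [v] = 0"
        using fun_cong[OF fun_cong[OF fun_cong[OF eq, of c], of t], of "[v]"] c t
        by (simp add: ext_d_def fun_times_form_def omit_nth_def)
      ultimately show ?thesis by (simp add: add_eq_0_iff2 mult_ac)
    qed
    then show "(?f has_derivative (\<lambda>v. ?f t * (- \<i> * lin_comb_forms \<xi> \<omega> c t [v]))) (at t)"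
      using d[unfolded frechet_derivative_works] by presburger
  qed
  then show ?thesis by (rule that) (rule f(2))
qed

text \<open>The zero set is closed by continuity and open by uniqueness for the equation, so connectedness leaves
only the alternatives of no zeros and no other values.\<close>
lemma flat_function_nonzero:
  fixes A :: "('a::topological_space, 'n::finite) chart set"
  assumes conn: "connected (UNIV :: 'a set)" and A: "smooth_atlas A"
    and \<omega>: "\<And>k. \<omega> k \<in> smooth_forms A 1" and f: "flat_function A \<omega> \<xi> f" and "f p \<noteq> 0"
  shows "f x \<noteq> 0"
proof -
  have d: "((\<lambda>s. f (chart_inv c s)) has_derivative
       (\<lambda>v. f (chart_inv c t) * (- \<i> * lin_comb_forms \<xi> \<omega> c t [v]))) (at t)"
    if "c \<in> A" "t \<in> chart_range c" for c t
    using f that by (simp add: flat_function_def)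
  have "open {x. f x = 0}"
  proof (rule open_if_open_in_charts[OF A])
    fix c assume c: "c \<in> A"
    show "open {t \<in> chart_range c. f (chart_inv c t) = 0}"
      by (rule open_zeros_log_derivative[OF open_chart_range[OF A c] d[OF c]], assumption)
         (intro smooth_on_imp_continuous_on smooth_on_mult smooth_on_const open_chart_range[OF A c]
            smooth_lin_comb_forms[OF A \<omega> c])
  qed
  moreover have "open {x. f x \<noteq> 0}"
  proof (rule open_if_open_in_charts[OF A])
    fix c assume c: "c \<in> A"
    have "continuous_on (chart_range c) (\<lambda>s. f (chart_inv c s))"
      using d[OF c] by (intro continuous_at_imp_continuous_on ballI has_derivative_continuous) blast
    then have "open ((\<lambda>s. f (chart_inv c s)) -` (- {0}) \<inter> chart_range c)"
      by (rule continuous_on_open_vimage[OF open_chart_range[OF A c], THEN iffD1, rule_format])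
         (rule open_Compl[OF closed_singleton])
    then show "open {t \<in> chart_range c. f (chart_inv c t) \<noteq> 0}"
      by (rule back_subst[of "open"]) auto
  qed
  ultimately have "{x. f x = 0} \<inter> UNIV = {} \<or> {x. f x \<noteq> 0} \<inter> UNIV = {}"
    by (rule connectedD[OF conn]) auto
  then show ?thesis using assms(5) by auto
qed

lemma flat_function_inverse:
  assumes "flat_function A \<omega> \<xi> f" and nz: "\<And>x. f x \<noteq> 0"
  shows "flat_function A \<omega> (- \<xi>) (\<lambda>x. inverse (f x))"
  unfolding flat_function_def
proof (intro ballI)
  fix c t assume "c \<in> A" "t \<in> chart_range c"
  then have d: "((\<lambda>s. f (chart_inv c s)) has_derivative
       (\<lambda>v. f (chart_inv c t) * (- \<i> * lin_comb_forms \<xi> \<omega> c t [v]))) (at t)"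
    using assms by (simp add: flat_function_def)
  have "lin_comb_forms (- \<xi>) \<omega> c t vs = - lin_comb_forms \<xi> \<omega> c t vs" for vs
    by (simp add: lin_comb_forms_def sum_negf)
  then show "((\<lambda>s. inverse (f (chart_inv c s))) has_derivative
       (\<lambda>v. inverse (f (chart_inv c t)) * (- \<i> * lin_comb_forms (- \<xi>) \<omega> c t [v]))) (at t)"
    using Deriv.has_derivative_inverse[OF nz d] nz by (simp add: field_simps)
qed

lemma zero_in_Gamma_group:
  assumes A: "smooth_atlas A"
  shows "0 \<in> Gamma_group A \<omega>"
proof -
  have "smooth_function A (\<lambda>p. 1)"
    using smooth_on_const open_chart_range[OF A] by (auto simp: smooth_function_def comp_def)
  moreover have "ext_d A (zero_form A (\<lambda>p. 1)) + fun_times_form (\<lambda>p. \<i> * 1) (lin_comb_forms 0 \<omega>) = 0"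
  proof (intro ext)
    fix c t and vs :: "(real ^ 'b) list"
    have "frechet_derivative (\<lambda>s. zero_form A (\<lambda>p. 1) c s ws) (at t) v = 0"
      if "c \<in> A" "t \<in> chart_range c" for ws v
    proof -
      have "frechet_derivative (\<lambda>s. if ws = [] then 1 else 0) (at t)
          = frechet_derivative (\<lambda>s. zero_form A (\<lambda>p. 1) c s ws) (at t)"
        by (rule frechet_derivative_transform_within_open[OF _ open_chart_range[OF A that(1)] that(2)])
           (use that(1) in \<open>auto simp: zero_form_def\<close>)
      then show ?thesis by (simp add: fun_eq_iff)
    qed
    then show "(ext_d A (zero_form A (\<lambda>p. 1)) + fun_times_form (\<lambda>p. \<i> * 1) (lin_comb_forms 0 \<omega>)) c t vs
        = 0 c t vs"
      by (simp add: ext_d_def fun_times_form_def lin_comb_forms_def)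
  qed
  ultimately show ?thesis by (auto simp: Gamma_group_def intro!: exI[of _ "\<lambda>p. 1"])
qed

section \<open>Characters of the torus\<close>

text \<open>The character \<open>exp (i \<xi> \<cdot> x)\<close>; it descends to the torus because \<open>\<xi>\<close> has integer entries.\<close>
lift_definition torus_char :: "int ^ 'm \<Rightarrow> 'm::finite torus \<Rightarrow> complex"
  is "\<lambda>\<xi> x. exp (\<i> * (\<Sum>k\<in>UNIV. of_int (\<xi> $ k) * of_real (x $ k)))"
proof -
  fix \<xi> :: "int ^ 'm" and x y :: "real ^ 'm"
  assume "torus_rel x y"
  then obtain k :: "int ^ 'm" where k: "\<And>i. x $ i = y $ i + 2 * pi * of_int (k $ i)"
    unfolding torus_rel_def by (metis add.commute diff_add_cancel)
  have "\<i> * (\<Sum>j\<in>UNIV. of_int (\<xi> $ j) * of_real (x $ j))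
      = \<i> * (\<Sum>j\<in>UNIV. of_int (\<xi> $ j) * of_real (y $ j))
        + 2 * of_int (\<Sum>j\<in>UNIV. \<xi> $ j * k $ j) * of_real pi * \<i>"
    unfolding k by (simp add: algebra_simps sum.distrib sum_distrib_left)
  then show "exp (\<i> * (\<Sum>j\<in>UNIV. of_int (\<xi> $ j) * of_real (x $ j)))
      = exp (\<i> * (\<Sum>j\<in>UNIV. of_int (\<xi> $ j) * of_real (y $ j)))"
    unfolding exp_eq by (intro exI[of _ "\<Sum>j\<in>UNIV. \<xi> $ j * k $ j"]) simp
qed

lemma torus_char_shift:
  "torus_char \<xi> (torus_shift y X) = exp (\<i> * (\<Sum>k\<in>UNIV. of_int (\<xi> $ k) * of_real (y $ k))) * torus_char \<xi> X"
  by transfer (simp add: exp_add[symmetric] ring_distribs sum.distrib)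

lemma torus_char_minus: "torus_char (- \<xi>) X * torus_char \<xi> X = 1"
  by transfer (simp add: exp_add[symmetric] sum_negf)

lemma torus_shift_add: "torus_shift y (torus_shift z X) = torus_shift (y + z) X"
  by (induct X rule: torus.abs_induct) (simp add: torus_shift.abs_eq add.assoc)

lemma torus_shift_zero: "torus_shift 0 X = X"
  by (induct X rule: torus.abs_induct) (simp add: torus_shift.abs_eq)

section \<open>Translations and multiplication by flat characters\<close>

lemma sum_fun_apply:
  fixes f :: "'i \<Rightarrow> 'x \<Rightarrow> 'y::comm_monoid_add"
  shows "(\<Sum>k\<in>K. f k) x = (\<Sum>k\<in>K. f k x)"
  by (induction K rule: infinite_finite_induct) auto

definition torus_translate ::
    "real ^ 'm \<Rightarrow> ('a, 'n::finite, 'm::finite) product_form \<Rightarrow> ('a, 'n, 'm) product_form" where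
  "torus_translate y u = (\<lambda>X. u (torus_shift y X))"

text \<open>Multiplication by the function \<open>g(t) exp (i \<xi> \<cdot> x)\<close> on the product. With \<open>\<xi> = 0\<close> and \<open>g\<close> constant it is
scalar multiplication, which lets the lemmas below on \<open>char_multiply \<xi> g u + v\<close> yield both the linear
structure of the complex and its invariance under multiplication.\<close>
definition char_multiply ::
    "int ^ 'm \<Rightarrow> ('a \<Rightarrow> complex) \<Rightarrow> ('a, 'n::finite, 'm::finite) product_form \<Rightarrow> ('a, 'n, 'm) product_form" where
  "char_multiply \<xi> g u = (\<lambda>X c t vs. g (chart_inv c t) * torus_char \<xi> X * u X c t vs)"

lemma section_smooth_on:
  "u \<in> smooth_sections A q \<Longrightarrow> c \<in> A \<Longrightarrow>
    smooth_on (chart_range c \<times> UNIV) (\<lambda>p. u (torus_class (snd p)) c (fst p) vs)"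
  by (simp add: smooth_sections_def case_prod_unfold)

lemma section_eq_zero:
  "u \<in> smooth_sections A q \<Longrightarrow> \<not> (c \<in> A \<and> t \<in> chart_range c) \<Longrightarrow> u X c t vs = 0"
  unfolding smooth_sections_def forms_def by blast

lemma section_differentiable:
  assumes "u \<in> smooth_sections A q" "c \<in> A" "t \<in> chart_range c"
  shows "(\<lambda>s. u X c s vs) differentiable (at t)"
    and "(\<lambda>s::real. u (torus_shift (s *\<^sub>R y) X) c t vs) differentiable (at s)"
proof -
  have d: "(\<lambda>p. u (torus_class (snd p)) c (fst p) vs) differentiable (at (t, x))" for x
    by (rule smooth_on_imp_differentiable[OF section_smooth_on[OF assms(1,2)]]) (use assms(3) in simp)
  show "(\<lambda>s. u X c s vs) differentiable (at t)"
  proof (induct X rule: torus.abs_induct)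
    case (1 x)
    have "(\<lambda>s. (s, x)) differentiable (at t)" by (auto simp: differentiable_def intro!: derivative_intros exI)
    from differentiable_compose[OF d[of x] this] show ?case by simp
  qed
  show "(\<lambda>s::real. u (torus_shift (s *\<^sub>R y) X) c t vs) differentiable (at s)"
  proof (induct X rule: torus.abs_induct)
    case (1 x)
    have "((\<lambda>s. (t, s *\<^sub>R y + x)) has_derivative (\<lambda>h. (0, h *\<^sub>R y))) (at s)"
      by (auto intro!: derivative_eq_intros)
    from differentiable_compose[OF d[of "s *\<^sub>R y + x"] differentiableI[OF this]] show ?case by (simp add: torus_shift.abs_eq)
  qed
qed

lemma torus_char_has_derivative:
  "((\<lambda>x. torus_char \<xi> (torus_class x)) has_derivative
     (\<lambda>w. torus_char \<xi> (torus_class x) * (\<i> * (\<Sum>k\<in>UNIV. of_int (\<xi> $ k) * of_real (w $ k))))) (at x)"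
proof -
  let ?L = "\<lambda>w :: real ^ 'a. \<i> * (\<Sum>k\<in>UNIV. of_int (\<xi> $ k) * complex_of_real (w $ k))"
  have "linear ?L"
    by (simp add: linear_iff distrib_left sum.distrib sum_distrib_left
        scaleR_conv_of_real[where 'a=complex] mult.left_commute)
  then have "(?L has_derivative ?L) (at x)"
    by (intro bounded_linear_imp_has_derivative) (simp add: linear_conv_bounded_linear)
  from has_derivative_compose[OF this DERIV_exp[unfolded has_field_derivative_def]]
  show ?thesis by (simp add: torus_char.abs_eq)
qed

lemma smooth_on_flat_function_char:
  fixes A :: "('a::topological_space, 'n::finite) chart set" and \<omega> :: "'m::finite \<Rightarrow> ('a, 'n) form"
    and \<xi> \<zeta> :: "int ^ 'm"
  assumes A: "smooth_atlas A" and \<omega>: "\<And>k. \<omega> k \<in> smooth_forms A 1"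
    and g: "flat_function A \<omega> \<xi> g" and c: "c \<in> A"
  shows "smooth_on (chart_range c \<times> UNIV) (\<lambda>p. g (chart_inv c (fst p)) * torus_char \<zeta> (torus_class (snd p)))"
proof (rule smooth_on_log_derivative)
  let ?h = "\<lambda>(v :: (real ^ 'n) \<times> (real ^ 'm)) (p :: (real ^ 'n) \<times> (real ^ 'm)). - \<i> * lin_comb_forms \<xi> \<omega> c (fst p) [fst v]
    + \<i> * (\<Sum>k\<in>UNIV. of_int (\<zeta> $ k) * of_real (snd v $ k))"
  show op: "open (chart_range c \<times> (UNIV :: (real ^ 'm) set))"
    by (intro open_Times open_UNIV open_chart_range[OF A c])
  show "smooth_on (chart_range c \<times> UNIV) (?h v)" for v
  proof (intro smooth_on_add smooth_on_mult smooth_on_const op)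
    show "smooth_on (chart_range c \<times> UNIV) (\<lambda>p :: (real ^ 'n) \<times> (real ^ 'm). lin_comb_forms \<xi> \<omega> c (fst p) [fst v])"
      using smooth_on_compose_affine[OF bounded_linear_fst op smooth_lin_comb_forms[OF A \<omega> c], of 0] by auto
  qed
  fix p :: "(real ^ 'n) \<times> (real ^ 'm)" assume "p \<in> chart_range c \<times> UNIV"
  then have "((\<lambda>s. g (chart_inv c s)) has_derivative
       (\<lambda>v. g (chart_inv c (fst p)) * (- \<i> * lin_comb_forms \<xi> \<omega> c (fst p) [v]))) (at (fst p))"
    using g c by (auto simp: flat_function_def)
  from has_derivative_mult[OF
      has_derivative_compose[OF bounded_linear_imp_has_derivative[OF bounded_linear_fst] this]
      has_derivative_compose[OF bounded_linear_imp_has_derivative[OF bounded_linear_snd] torus_char_has_derivative]]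
  show "((\<lambda>p. g (chart_inv c (fst p)) * torus_char \<zeta> (torus_class (snd p))) has_derivative
      (\<lambda>v. g (chart_inv c (fst p)) * torus_char \<zeta> (torus_class (snd p)) * ?h v p)) (at p)"
    by (rule has_derivative_eq_rhs) (simp add: fun_eq_iff algebra_simps)
qed

lemma forms_multiply_add:
  assumes A: "smooth_atlas A" and "\<eta> \<in> forms A q" "\<theta> \<in> forms A q"
  shows "(\<lambda>c t vs. \<phi> (chart_inv c t) * \<eta> c t vs + \<theta> c t vs) \<in> forms A q"
proof -
  have "alternating_multilinear q (\<lambda>vs. a * h vs + k vs)"
    if "alternating_multilinear q h" "alternating_multilinear q k" for a h k
    using that unfolding alternating_multilinear_def linear_iff by (simp add: algebra_simps)
  note am = this
  have z: "\<eta> c t vs = 0" "\<theta> c t vs = 0" if "\<not> (c \<in> A \<and> t \<in> chart_range c \<and> length vs = q)" for c t vs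
    using assms(2,3) that unfolding forms_def by blast+
  have alt: "alternating_multilinear q (\<eta> c t)" "alternating_multilinear q (\<theta> c t)"
    if "c \<in> A" "t \<in> chart_range c" for c t
    using assms(2,3) that unfolding forms_def by blast+
  have tr: "\<eta> c t vs = \<eta> c' (transition c c' t) (map (frechet_derivative (transition c c') (at t)) vs)"
    "\<theta> c t vs = \<theta> c' (transition c c' t) (map (frechet_derivative (transition c c') (at t)) vs)"
    if "c \<in> A" "c' \<in> A" "t \<in> overlap c c'" "length vs = q" for c c' t vs
    using assms(2,3) that unfolding forms_def by blast+
  show ?thesis
    unfolding forms_def
    by (intro CollectI conjI allI ballI impI am alt)
       (auto simp: z tr[symmetric] chart_inv_transition[OF A])
qed

lemma char_multiply_add_sections:
  fixes A :: "('a::topological_space, 'n::finite) chart set" and \<omega> :: "'m::finite \<Rightarrow> ('a, 'n) form"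
    and u v :: "('a, 'n, 'm) product_form"
  assumes A: "smooth_atlas A" and \<omega>: "\<And>k. \<omega> k \<in> smooth_forms A 1" and g: "flat_function A \<omega> \<xi> g"
    and u: "u \<in> smooth_sections A q" and v: "v \<in> smooth_sections A q"
  shows "char_multiply \<zeta> g u + v \<in> smooth_sections A q"
proof -
  have "(char_multiply \<zeta> g u + v) X \<in> forms A q" for X
    using forms_multiply_add[OF A, of "u X" q "v X" "\<lambda>p. g p * torus_char \<zeta> X"] u v
    by (simp add: smooth_sections_def char_multiply_def plus_fun_def)
  moreover have "smooth_on (chart_range c \<times> UNIV)
      (\<lambda>p. (char_multiply \<zeta> g u + v) (torus_class (snd p)) c (fst p) vs)" if c: "c \<in> A" for c vs
  proof -
    have op: "open (chart_range c \<times> (UNIV :: (real ^ 'm) set))"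
      by (intro open_Times open_UNIV open_chart_range[OF A c])
    from smooth_on_add[OF op smooth_on_mult[OF op smooth_on_flat_function_char[OF A \<omega> g c]
          section_smooth_on[OF u c]] section_smooth_on[OF v c]]
    show ?thesis unfolding char_multiply_def plus_fun_def .
  qed
  ultimately show ?thesis
    unfolding smooth_sections_def case_prod_unfold by blast
qed

text \<open>The function \<open>F = g(t) exp (i \<xi> \<cdot> x)\<close> is annihilated by \<open>d'\<close>: the term \<open>dg\<close> contributes
\<open>- i F (\<xi> \<cdot> \<omega>)\<close>, and differentiating the character along the torus contributes \<open>i F (\<xi> \<cdot> \<omega>)\<close>.
By the Leibniz rule multiplication by \<open>F\<close> therefore commutes with \<open>d'\<close>.\<close>
lemma dprime_char_multiply_add:
  fixes A :: "('a::topological_space, 'n::finite) chart set" and \<omega> :: "'m::finite \<Rightarrow> ('a, 'n) form"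
    and u v :: "('a, 'n, 'm) product_form"
  assumes \<omega>: "\<And>k. \<omega> k \<in> smooth_forms A 1" and g: "flat_function A \<omega> \<xi> g"
    and u: "u \<in> smooth_sections A q" and v: "v \<in> smooth_sections A q"
  shows "dprime A \<omega> (char_multiply \<xi> g u + v) = char_multiply \<xi> g (dprime A \<omega> u) + dprime A \<omega> v"
proof (intro ext)
  fix X t vs and c :: "('a, 'n) chart"
  let ?F = "g (chart_inv c t) * torus_char \<xi> X"
  show "dprime A \<omega> (char_multiply \<xi> g u + v) X c t vs
    = (char_multiply \<xi> g (dprime A \<omega> u) + dprime A \<omega> v) X c t vs"
  proof (cases "c \<in> A \<and> t \<in> chart_range c")
    case False
    \<comment> \<open>Outside the chart domains all representatives are 0 by convention.\<close>
    then have "\<omega> k c t ws = 0" for k ws using \<omega>[of k] unfolding smooth_forms_def forms_def by blast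
    then show ?thesis
      using False by (auto simp: dprime_def ext_d_def wedge1_def char_multiply_def sum_fun_apply)
  next
    case True
    then have c: "c \<in> A" and t: "t \<in> chart_range c" by auto
    let ?D = "\<lambda>u ws. frechet_derivative (\<lambda>s. u X c s ws) (at t)"
    let ?P = "\<lambda>k u ws. torus_partial k u X c t ws"
    have D: "?D (char_multiply \<xi> g u + v) ws w
        = ?F * ?D u ws w - \<i> * ?F * lin_comb_forms \<xi> \<omega> c t [w] * u X c t ws + ?D v ws w" for ws w
    proof -
      have "((\<lambda>s. g (chart_inv c s)) has_derivative
         (\<lambda>v. g (chart_inv c t) * (- \<i> * lin_comb_forms \<xi> \<omega> c t [v]))) (at t)"
        using g c t by (auto simp: flat_function_def)
      note d = has_derivative_add[OF has_derivative_mult[OF has_derivative_mult[OF this has_derivative_const[of "torus_char \<xi> X"]]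
          section_differentiable(1)[OF u c t, of X ws, unfolded frechet_derivative_works]]
          section_differentiable(1)[OF v c t, of X ws, unfolded frechet_derivative_works]]
      show ?thesis
        unfolding char_multiply_def plus_fun_def frechet_derivative_at[OF d, symmetric]
        by (simp add: algebra_simps)
    qed
    have P: "?P k (char_multiply \<xi> g u + v) ws
        = ?F * ?P k u ws + \<i> * of_int (\<xi> $ k) * ?F * u X c t ws + ?P k v ws" for k ws
    proof -
      have char: "torus_char \<xi> (torus_shift (s *\<^sub>R axis k 1) X)
          = exp (s *\<^sub>R (\<i> * of_int (\<xi> $ k))) * torus_char \<xi> X" for s
      proof -
        have "(\<Sum>j\<in>UNIV. of_int (\<xi> $ j) * complex_of_real ((s *\<^sub>R axis k 1) $ j)) = of_int (\<xi> $ k) * of_real s"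
          by (simp add: axis_def if_distrib cong: if_cong)
        then show ?thesis by (simp add: torus_char_shift scaleR_conv_of_real mult_ac)
      qed
      have "((\<lambda>s. exp (s *\<^sub>R (\<i> * of_int (\<xi> $ k)))) has_vector_derivative \<i> * of_int (\<xi> $ k)) (at 0)"
        using exp_scaleR_has_vector_derivative_right[of "\<i> * of_int (\<xi> $ k)" 0 UNIV] by simp
      from has_vector_derivative_mult[OF this has_vector_derivative_const[of "torus_char \<xi> X"]]
      have "((\<lambda>s. torus_char \<xi> (torus_shift (s *\<^sub>R axis k 1) X)) has_vector_derivative
          \<i> * of_int (\<xi> $ k) * torus_char \<xi> X) (at 0)"
        unfolding char by simp
      note d = has_vector_derivative_add[OF
          has_vector_derivative_mult[OF has_vector_derivative_mult[OF has_vector_derivative_const[of "g (chart_inv c t)"] this]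
            section_differentiable(2)[OF u c t, of "axis k 1" X ws 0, unfolded vector_derivative_works]]
          section_differentiable(2)[OF v c t, of "axis k 1" X ws 0, unfolded vector_derivative_works]]
      show ?thesis
        unfolding torus_partial_def char_multiply_def plus_fun_def
        using vector_derivative_at[OF d]
        by (simp add: algebra_simps torus_shift_zero)
    qed
    let ?s = "\<lambda>i. (-1) ^ i :: complex"
    let ?o = "\<lambda>i. omit_nth i vs"
    have dp: "dprime A \<omega> u X c t vs = (\<Sum>i<length vs. ?s i * ?D u (?o i) (vs ! i)
        + ?s i * (\<Sum>k\<in>UNIV. \<omega> k c t [vs ! i] * ?P k u (?o i)))" for u
      unfolding dprime_def ext_d_def wedge1_def sum.distrib
      using c t by (simp add: sum_fun_apply sum_distrib_left mult.assoc sum.swap[of _ UNIV])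
    have "dprime A \<omega> (char_multiply \<xi> g u + v) X c t vs
      = (\<Sum>i<length vs. ?F * (?s i * ?D u (?o i) (vs ! i) + ?s i * (\<Sum>k\<in>UNIV. \<omega> k c t [vs ! i] * ?P k u (?o i)))
          + (?s i * ?D v (?o i) (vs ! i) + ?s i * (\<Sum>k\<in>UNIV. \<omega> k c t [vs ! i] * ?P k v (?o i))))"
      unfolding dp D P lin_comb_forms_def
      by (intro sum.cong refl) (simp add: algebra_simps sum.distrib sum_distrib_left)
    also have "\<dots> = (char_multiply \<xi> g (dprime A \<omega> u) + dprime A \<omega> v) X c t vs"
    proof -
      have "(\<Sum>i<n. F * a i + b i) = F * (\<Sum>i<n. a i) + (\<Sum>i<n. b i)"
        for n F and a b :: "nat \<Rightarrow> complex"
        by (simp add: sum.distrib sum_distrib_left)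
      then show ?thesis unfolding char_multiply_def plus_fun_apply dp .
    qed
    finally show ?thesis .
  qed
qed

section \<open>The complex as a representation of translations and multiplications\<close>

interpretation sections: vector_space section_scale
  by unfold_locales (simp_all add: fun_eq_iff section_scale_def algebra_simps)

lemma torus_char_zero: "torus_char 0 X = 1"
  by transfer simp

lemma section_scale_eq_char_multiply: "section_scale a = char_multiply 0 (\<lambda>p. a)"
  by (simp add: fun_eq_iff section_scale_def char_multiply_def torus_char_zero)

lemma flat_function_const: "flat_function A \<omega> 0 (\<lambda>p. a)"
  by (simp add: flat_function_def lin_comb_forms_def)

lemma char_multiply_linear: "Vector_Spaces.linear section_scale section_scale (char_multiply \<xi> g)"
  by unfold_locales (simp_all add: fun_eq_iff section_scale_def char_multiply_def algebra_simps)

lemma torus_translate_linear: "Vector_Spaces.linear section_scale section_scale (torus_translate y)"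
  by unfold_locales (simp_all add: fun_eq_iff section_scale_def torus_translate_def)

lemma zero_in_smooth_sections:
  assumes "smooth_atlas A"
  shows "0 \<in> smooth_sections A q"
  using open_chart_range[OF assms]
  by (auto simp: smooth_sections_def forms_def alternating_multilinear_def case_prod_unfold linear_iff
      intro!: smooth_on_const open_Times)

lemma dprime_zero: "dprime A \<omega> 0 = 0"
  by (simp add: fun_eq_iff dprime_def ext_d_def wedge1_def torus_partial_def sum_fun_apply)

lemma cocycles_char_multiply_add:
  assumes "smooth_atlas A" "\<And>k. \<omega> k \<in> smooth_forms A 1" "flat_function A \<omega> \<xi> g"
    and "u \<in> cocycles A \<omega> q" "v \<in> cocycles A \<omega> q"
  shows "char_multiply \<xi> g u + v \<in> cocycles A \<omega> q"
  using assms char_multiply_add_sections[OF assms(1-3), of u q v \<xi>]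
    dprime_char_multiply_add[OF assms(2,3), of u q v]
  by (simp add: cocycles_def fun_eq_iff char_multiply_def)

lemma coboundaries_char_multiply_add:
  assumes "smooth_atlas A" "\<And>k. \<omega> k \<in> smooth_forms A 1" "flat_function A \<omega> \<xi> g"
    and "u \<in> coboundaries A \<omega> q" "v \<in> coboundaries A \<omega> q"
  shows "char_multiply \<xi> g u + v \<in> coboundaries A \<omega> q"
proof (cases q)
  case 0
  then show ?thesis using assms(4,5) by (simp add: coboundaries_def fun_eq_iff char_multiply_def)
next
  case (Suc p)
  then obtain u' v' where u': "u = dprime A \<omega> u'" "u' \<in> smooth_sections A p"
    and v': "v = dprime A \<omega> v'" "v' \<in> smooth_sections A p"
    using assms(4,5) by (auto simp: coboundaries_def)
  have "dprime A \<omega> (char_multiply \<xi> g u' + v') \<in> dprime A \<omega> ` smooth_sections A p"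
    by (intro imageI char_multiply_add_sections[OF assms(1-3) u'(2) v'(2)])
  then show ?thesis
    using dprime_char_multiply_add[OF assms(2,3) u'(2) v'(2)] by (simp add: coboundaries_def Suc u' v')
qed

lemma
  assumes A: "smooth_atlas A" and \<omega>: "\<And>k. \<omega> k \<in> smooth_forms A 1"
  shows subspace_cocycles: "sections.subspace (cocycles A \<omega> q)"
    and subspace_coboundaries: "sections.subspace (coboundaries A \<omega> q)"
proof -
  have one: "char_multiply 0 (\<lambda>p. 1) u = u" for u :: "('a, 'b, 'c) product_form"
    unfolding section_scale_eq_char_multiply[symmetric] by simp
  have *: "sections.subspace Z"
    if 0: "0 \<in> Z" and Z: "\<And>u v a. u \<in> Z \<Longrightarrow> v \<in> Z \<Longrightarrow> char_multiply 0 (\<lambda>p. a) u + v \<in> Z"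
    for Z :: "('a, 'b, 'c) product_form set"
  proof (rule sections.subspaceI[OF 0])
    show "u + v \<in> Z" if "u \<in> Z" "v \<in> Z" for u v using Z[OF that, of 1] by (simp add: one)
    show "section_scale a u \<in> Z" if "u \<in> Z" for a u
      using Z[OF that 0, of a] by (simp add: section_scale_eq_char_multiply)
  qed
  show "sections.subspace (cocycles A \<omega> q)"
    by (rule *[OF _ cocycles_char_multiply_add[OF A \<omega> flat_function_const]])
       (auto simp: cocycles_def dprime_zero zero_in_smooth_sections[OF A])
  have "0 \<in> coboundaries A \<omega> q"
  proof (cases q)
    case (Suc p)
    then show ?thesis
      using zero_in_smooth_sections[OF A, of p]
      by (auto simp: coboundaries_def dprime_zero intro!: rev_image_eqI)
  qed (simp add: coboundaries_def)
  then show "sections.subspace (coboundaries A \<omega> q)"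
    by (rule *[OF _ coboundaries_char_multiply_add[OF A \<omega> flat_function_const]])
qed

lemma torus_translate_sections:
  assumes A: "smooth_atlas A" and u: "u \<in> smooth_sections A q"
  shows "torus_translate y u \<in> smooth_sections A q"
proof -
  have "smooth_on (chart_range c \<times> UNIV) (\<lambda>p. torus_translate y u (torus_class (snd p)) c (fst p) vs)"
    if c: "c \<in> A" for c vs
  proof -
    have "open (chart_range c \<times> UNIV)" by (intro open_Times open_UNIV open_chart_range[OF A c])
    from smooth_on_compose_affine[OF bounded_linear_ident this section_smooth_on[OF u c], of "(0, y)"]
    show ?thesis by (auto simp: torus_translate_def torus_shift.abs_eq add.commute)
  qed
  then show ?thesis
    using u unfolding smooth_sections_def case_prod_unfold by (auto simp: torus_translate_def)
qed

lemma dprime_torus_translate: "dprime A \<omega> (torus_translate y u) = torus_translate y (dprime A \<omega> u)"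
  by (simp add: fun_eq_iff dprime_def torus_partial_def torus_translate_def torus_shift_add add.commute)

lemma torus_translate_cocycles:
  "smooth_atlas A \<Longrightarrow> u \<in> cocycles A \<omega> q \<Longrightarrow> torus_translate y u \<in> cocycles A \<omega> q"
  by (simp add: cocycles_def torus_translate_sections dprime_torus_translate)
     (simp add: torus_translate_def fun_eq_iff)

lemma torus_translate_coboundaries:
  assumes "smooth_atlas A" "u \<in> coboundaries A \<omega> q"
  shows "torus_translate y u \<in> coboundaries A \<omega> q"
proof (cases q)
  case 0
  then show ?thesis using assms(2) by (simp add: coboundaries_def torus_translate_def fun_eq_iff)
next
  case (Suc p)
  then obtain u' where u': "u = dprime A \<omega> u'" "u' \<in> smooth_sections A p"
    using assms(2) by (auto simp: coboundaries_def)
  have "dprime A \<omega> (torus_translate y u') \<in> dprime A \<omega> ` smooth_sections A p"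
    by (intro imageI torus_translate_sections[OF assms(1) u'(2)])
  then show ?thesis by (simp add: coboundaries_def Suc u' dprime_torus_translate)
qed

lemma torus_translate_inverse: "torus_translate (- y) (torus_translate y u) = u"
  by (simp add: torus_translate_def torus_shift_add torus_shift_zero)

lemma char_multiply_inverse:
  assumes "\<And>p. g p \<noteq> 0"
  shows "char_multiply (- \<xi>) (\<lambda>p. inverse (g p)) (char_multiply \<xi> g u) = u"
proof (intro ext)
  fix X c t vs
  have "inverse (g (chart_inv c t)) * torus_char (- \<xi>) X * (g (chart_inv c t) * torus_char \<xi> X * u X c t vs)
    = (inverse (g (chart_inv c t)) * g (chart_inv c t)) * (torus_char (- \<xi>) X * torus_char \<xi> X) * u X c t vs"
    by (simp only: mult_ac)
  then show "char_multiply (- \<xi>) (\<lambda>p. inverse (g p)) (char_multiply \<xi> g u) X c t vs = u X c t vs"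
    using assms by (simp add: char_multiply_def torus_char_minus)
qed

text \<open>The twisted commutation relation that drives the proof: a translation multiplies the character by the
constant \<open>exp (i \<xi> \<cdot> y)\<close>.\<close>
lemma torus_translate_char_multiply:
  "torus_translate y (char_multiply \<xi> g u)
    = section_scale (exp (\<i> * (\<Sum>k\<in>UNIV. of_int (\<xi> $ k) * of_real (y $ k)))) (char_multiply \<xi> g (torus_translate y u))"
  by (simp add: fun_eq_iff torus_translate_def char_multiply_def section_scale_def torus_char_shift)

section \<open>Dimension of the cohomology\<close>

lemma cohomology_dim_pos_imp_nontrivial:
  assumes B: "sections.subspace (coboundaries A \<omega> q)" and "0 < cohomology_dim A \<omega> q"
  obtains u where "u \<in> cocycles A \<omega> q" "u \<notin> coboundaries A \<omega> q"
proof -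
  let ?Z = "cocycles A \<omega> q" and ?B = "coboundaries A \<omega> q"
  let ?R = "{(u, v). u \<in> ?Z \<and> v \<in> ?Z \<and> u - v \<in> ?B}"
  obtain S where S: "S \<subseteq> cohomology A \<omega> q" "finite S" "independent_classes A \<omega> q S" "0 < card S"
    using assms(2) unfolding cohomology_dim_def less_Sup_iff by (auto simp: zero_enat_def)
  then obtain C where C: "C \<in> S" by fastforce
  have "\<exists>u. u \<in> ?Z \<and> u \<in> D" if "D \<in> S" for D
  proof -
    have "D \<in> ?Z // ?R" using S(1) that unfolding cohomology_def by blast
    then obtain u where "u \<in> ?Z" "D = ?R `` {u}" by (rule quotientE)
    then show ?thesis using sections.subspace_0[OF B] by (intro exI[of _ u]) auto
  qed
  then obtain r where r: "\<And>D. D \<in> S \<Longrightarrow> r D \<in> ?Z \<and> r D \<in> D" by metis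
  have "r C \<notin> ?B"
  proof
    assume "r C \<in> ?B"
    moreover have "(\<Sum>D\<in>S. section_scale (if D = C then 1 else 0) (r D)) = r C"
      using S(2) C by (simp add: if_distrib[of "\<lambda>a. section_scale a _"] cong: if_cong)
    ultimately have "(if C = C then 1 else 0 :: complex) = 0"
      using S(3)[unfolded independent_classes_def, rule_format, of r "\<lambda>D. if D = C then 1 else 0" C] r C
      by simp
    then show False by simp
  qed
  then show ?thesis using that r C by blast
qed

text \<open>Independence modulo coboundaries makes the classes pairwise distinct, so that \<open>n\<close> vectors really give
\<open>n\<close> classes, and it does not depend on the representatives.\<close>
lemma independent_mod_imp_cohomology_dim_ge:
  fixes A :: "('a::topological_space, 'n::finite) chart set" and \<omega> :: "'m::finite \<Rightarrow> ('a, 'n) form"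
  assumes B: "sections.subspace (coboundaries A \<omega> q)"
    and w: "\<And>k. w k \<in> cocycles A \<omega> q" and ind: "sections.independent_mod (coboundaries A \<omega> q) n w"
  shows "enat n \<le> cohomology_dim A \<omega> q"
proof -
  let ?Z = "cocycles A \<omega> q" and ?B = "coboundaries A \<omega> q"
  let ?R = "{(u, v). u \<in> ?Z \<and> v \<in> ?Z \<and> u - v \<in> ?B}"
  define cls where "cls k = ?R `` {w k}" for k
  have in_cls: "v \<in> cls k \<longleftrightarrow> v \<in> ?Z \<and> w k - v \<in> ?B" for v k
    using w[of k] by (simp add: cls_def)
  have ind: "a k = 0" if "(\<Sum>k<n. section_scale (a k) (w k)) \<in> ?B" "k < n" for a k
    using ind that unfolding sections.independent_mod_def by blast
  have inj: "inj_on cls {..<n}"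
  proof (rule inj_onI, rule ccontr)
    fix i j assume ij: "i \<in> {..<n}" "j \<in> {..<n}" "cls i = cls j" "i \<noteq> j"
    \<comment> \<open>Equal classes would give the nontrivial relation \<open>w i - w j\<close> in the coboundaries.\<close>
    have "w j \<in> cls j" using w sections.subspace_0[OF B] by (simp add: in_cls)
    then have "w j \<in> cls i" using ij(3) by simp
    then have "w i - w j \<in> ?B" by (simp add: in_cls)
    moreover have "(\<Sum>k<n. section_scale (of_bool (k = i) - of_bool (k = j)) (w k)) = w i - w j"
      using ij by (simp add: sections.scale_left_diff_distrib sum_subtractf of_bool_def
          if_distrib[of "\<lambda>a. section_scale a _"] cong: if_cong)
    ultimately have "of_bool (i = i) - of_bool (i = j) = (0 :: complex)"
      using ij(1) ind[of "\<lambda>k. of_bool (k = i) - of_bool (k = j)" i] by simp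
    then show False using ij(4) by simp
  qed
  have "independent_classes A \<omega> q (cls ` {..<n})"
    unfolding independent_classes_def
  proof (intro allI impI, elim conjE)
    fix r :: "('a, 'n, 'm) product_form set \<Rightarrow> ('a, 'n, 'm) product_form" and a
    assume r: "\<forall>C\<in>cls ` {..<n}. r C \<in> C"
      and sum: "(\<Sum>C\<in>cls ` {..<n}. section_scale (a C) (r C)) \<in> ?B"
    have "w k - r (cls k) \<in> ?B" if "k < n" for k
    proof -
      have "r (cls k) \<in> cls k" by (rule bspec[OF r]) (use that in simp)
      then show ?thesis by (simp add: in_cls)
    qed
    then have "(\<Sum>k<n. section_scale (a (cls k)) (w k - r (cls k))) \<in> ?B"
      by (intro sections.subspace_sum[OF B] sections.subspace_scale[OF B]) simp
    moreover have "(\<Sum>k<n. section_scale (a (cls k)) (r (cls k))) \<in> ?B"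
      using sum unfolding sum.reindex[OF inj] o_def .
    ultimately have "(\<Sum>k<n. section_scale (a (cls k)) (w k - r (cls k)))
        + (\<Sum>k<n. section_scale (a (cls k)) (r (cls k))) \<in> ?B"
      by (rule sections.subspace_add[OF B])
    then have "(\<Sum>k<n. section_scale (a (cls k)) (w k)) \<in> ?B"
      by (simp add: sections.scale_right_diff_distrib sum_subtractf)
    from ind[OF this] show "\<forall>C\<in>cls ` {..<n}. a C = 0" by simp
  qed
  moreover have "cls ` {..<n} \<subseteq> cohomology A \<omega> q"
    unfolding cohomology_def cls_def by (intro image_subsetI quotientI w)
  moreover have "card (cls ` {..<n}) = n" using card_image[OF inj] by simp
  ultimately show ?thesis
    unfolding cohomology_dim_def
    by (intro Sup_upper CollectI exI[of _ "cls ` {..<n}"] conjI) (assumption | simp)+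
qed

lemma inj_on_root_of_unity_powers:
  assumes "n > 0"
  shows "inj_on (\<lambda>k. exp (\<i> * (2 * pi / n)) ^ k) {..<n}"
proof (rule inj_onI)
  fix j k assume jk: "j \<in> {..<n}" "k \<in> {..<n}"
    "exp (\<i> * (2 * pi / n)) ^ j = exp (\<i> * (2 * pi / n)) ^ k"
  then have "exp (2 * of_real pi * \<i> * of_nat j / of_nat n) = exp (2 * of_real pi * \<i> * of_nat k / of_nat n)"
    unfolding exp_of_nat_mult[symmetric] by (simp add: mult_ac)
  then show "j = k" using complex_root_unity_eq[of n j k] assms jk(1,2) by (simp add: cong_def)
qed

text \<open>For given \<open>n\<close> the translation is chosen along a coordinate \<open>j\<close> with \<open>\<xi>\<^sub>j \<noteq> 0\<close>, so that the constant in the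
commutation relation is a primitive \<open>n\<close>-th root of unity; its first \<open>n\<close> powers are distinct, which
yields \<open>n\<close> independent classes.\<close>
lemma cohomology_dim_infinite:
  fixes A :: "('a::topological_space, 'n::finite) chart set" and \<omega> :: "'m::finite \<Rightarrow> ('a, 'n) form"
  assumes conn: "connected (UNIV :: 'a set)" and A: "smooth_atlas A"
    and \<omega>: "\<And>k. \<omega> k \<in> smooth_forms A 1"
    and \<xi>: "\<xi> \<in> Gamma_group A \<omega>" "\<xi> \<noteq> 0" and pos: "0 < cohomology_dim A \<omega> q"
  shows "cohomology_dim A \<omega> q = \<infinity>"
proof -
  let ?Z = "cocycles A \<omega> q" and ?B = "coboundaries A \<omega> q"
  obtain f p where f: "flat_function A \<omega> \<xi> f" "f p \<noteq> 0"
    by (rule Gamma_group_flat_function[OF A \<xi>(1)])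
  have nz: "f x \<noteq> 0" for x using flat_function_nonzero[OF conn A \<omega> f] .
  note f' = flat_function_inverse[OF f(1) nz]
  obtain j where j: "\<xi> $ j \<noteq> 0" using \<xi>(2) by (auto simp: vec_eq_iff)
  note Z = subspace_cocycles[OF A \<omega>, where q=q] and B = subspace_coboundaries[OF A \<omega>, where q=q]
  obtain u where u: "u \<in> ?Z" "u \<notin> ?B" by (rule cohomology_dim_pos_imp_nontrivial[OF B pos])
  let ?M = "char_multiply \<xi> f" and ?M' = "char_multiply (- \<xi>) (\<lambda>p. inverse (f p))"
  have MZ: "?M v \<in> ?Z" if "v \<in> ?Z" for v
    using cocycles_char_multiply_add[OF A \<omega> f(1) that sections.subspace_0[OF Z]] by simp
  have MB: "?M v \<in> ?B \<longleftrightarrow> v \<in> ?B" for v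
    using coboundaries_char_multiply_add[OF A \<omega> f(1) _ sections.subspace_0[OF B], of v]
      coboundaries_char_multiply_add[OF A \<omega> f' _ sections.subspace_0[OF B], of "?M v"]
    by (auto simp: char_multiply_inverse[OF nz])
  have TB: "torus_translate y v \<in> ?B \<longleftrightarrow> v \<in> ?B" for y v
    using torus_translate_coboundaries[OF A, where u=v and y=y]
      torus_translate_coboundaries[OF A, where u="torus_translate y v" and y="- y"]
    by (auto simp: torus_translate_inverse)
  have "enat n \<le> cohomology_dim A \<omega> q" if n: "n > 0" for n
  proof -
    define y :: "real ^ 'm" where "y = axis j (2 * pi / (n * \<xi> $ j))"
    have "(\<Sum>k\<in>UNIV. of_int (\<xi> $ k) * complex_of_real (y $ k))
        = of_int (\<xi> $ j) * complex_of_real (2 * pi / (n * \<xi> $ j))"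
      by (simp add: y_def axis_def if_distrib cong: if_cong)
    also have "\<dots> = 2 * pi / n" using j by simp
    finally have TM: "torus_translate y (?M v) = section_scale (exp (\<i> * (2 * pi / n))) (?M (torus_translate y v))"
      for v by (simp add: torus_translate_char_multiply)
    obtain w where w: "\<And>k. w k \<in> ?Z" "sections.independent_mod ?B n w"
      using independent_mod_twisted_commuting[OF sections.vector_space_axioms B Z
          torus_translate_linear char_multiply_linear torus_translate_cocycles[OF A] MZ TB MB TM
          inj_on_root_of_unity_powers[OF n] u] by blast
    show ?thesis by (rule independent_mod_imp_cohomology_dim_ge[OF B w])
  qed
  note ge = this
  show ?thesis
  proof (rule ccontr)
    assume "cohomology_dim A \<omega> q \<noteq> \<infinity>"
    then obtain N where "cohomology_dim A \<omega> q = enat N" by auto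
    then show False using ge[of "Suc N"] by simp
  qed
qed

theorem corollary7p3:
  fixes A :: "('a::{t2_space, second_countable_topology}, 'n::finite) chart set"
    and \<omega> :: "'m::finite \<Rightarrow> ('a, 'n) form"
  assumes "compact (UNIV :: 'a set)" and "connected (UNIV :: 'a set)"
    and "oriented_atlas A"
    and "\<And>k. \<omega> k \<in> smooth_forms A 1"
    and "\<And>k. ext_d A (\<omega> k) = 0"
    and "\<exists>q\<in>{0..CARD('n)}. 0 < cohomology_dim A \<omega> q \<and> cohomology_dim A \<omega> q < \<infinity>"
  shows "Gamma_group A \<omega> = {0}"
proof -
  have A: "smooth_atlas A" using assms(3) by (simp add: oriented_atlas_def)
  obtain q where q: "0 < cohomology_dim A \<omega> q" "cohomology_dim A \<omega> q < \<infinity>"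
    using assms(6) by auto
  have "\<xi> = 0" if "\<xi> \<in> Gamma_group A \<omega>" for \<xi>
  proof (rule ccontr)
    assume "\<xi> \<noteq> 0"
    then have "cohomology_dim A \<omega> q = \<infinity>"
      by (rule cohomology_dim_infinite[OF assms(2) A assms(4) that _ q(1)])
    then show False using q(2) by simp
  qed
  then show ?thesis using zero_in_Gamma_group[OF A] by blast
qed

end
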